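(* Every connected locally Dirac graph $G$ of order at least $3$ is fully cycle extendable.
   Context: All graphs are finite, simple, and undirected. $n(G)$ is the order and $\delta(G)$ the minimum degree of $G$; $N_G(u)$ is the (open) neighborhood and $d_G(u)$ the degree of $u$ in $G$. $G$ is locally Dirac if $2\delta(G[N_G(u)])\geq d_G(u)$ for every vertex $u$ of $G$, where $G[N_G(u)]$ is the subgraph of $G$ induced by $N_G(u)$. A cycle $C$ in $G$ is extendable if $G$ contains a cycle $C'$ of order $n(C)+1$ with $V(C)\subseteq V(C')$. $G$ is fully cycle extendable if every vertex of $G$ lies on a triangle and every cycle in $G$ of order less than $n(G)$ is extendable. *)

theory Defs
  imports "Graph_Theory.Digraph_Component"
begin

text \<open>
  A finite simple undirected graph is a symmetric digraph in the sense of the locale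
  \<^locale>\<open>graph\<close>: finite, without loops and parallel arcs, each edge being represented by a
  pair of opposite arcs. Hence \<^const>\<open>out_degree\<close> is the degree.
\<close>

definition neighborhood :: "('a, 'b) pre_digraph \<Rightarrow> 'a \<Rightarrow> 'a set" where
  "neighborhood G u = {v. u \<rightarrow>\<^bsub>G\<^esub> v}"

text \<open>The minimum degree of the graph without vertices is taken to be 0.\<close>

definition min_degree :: "('a, 'b) pre_digraph \<Rightarrow> nat" where
  "min_degree G = (if verts G = {} then 0 else Min (out_degree G ` verts G))"

definition locally_Dirac :: "('a, 'b) pre_digraph \<Rightarrow> bool" where
  "locally_Dirac G \<longleftrightarrow>
    (\<forall>u \<in> verts G. 2 * min_degree (G \<restriction> neighborhood G u) \<ge> out_degree G u)"

definition cycle_verts :: "('a, 'b) pre_digraph \<Rightarrow> 'b list \<Rightarrow> 'a set" where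
  "cycle_verts G p = tail G ` set p"

text \<open>
  The closed arc walks accepted by \<^const>\<open>pre_digraph.cycle\<close> include a walk along an edge and
  back again, so cycles of an undirected graph are those with at least three vertices.
\<close>

definition graph_cycle :: "('a, 'b) pre_digraph \<Rightarrow> 'b list \<Rightarrow> bool" where
  "graph_cycle G p \<longleftrightarrow> pre_digraph.cycle G p \<and> card (cycle_verts G p) \<ge> 3"

definition extendable :: "('a, 'b) pre_digraph \<Rightarrow> 'b list \<Rightarrow> bool" where
  "extendable G p \<longleftrightarrow>
    (\<exists>q. graph_cycle G q \<and> card (cycle_verts G q) = card (cycle_verts G p) + 1 \<and>
         cycle_verts G p \<subseteq> cycle_verts G q)"

definition fully_cycle_extendable :: "('a, 'b) pre_digraph \<Rightarrow> bool" where
  "fully_cycle_extendable G \<longleftrightarrow>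
    (\<forall>u \<in> verts G. \<exists>p. graph_cycle G p \<and> card (cycle_verts G p) = 3 \<and> u \<in> cycle_verts G p) \<and>
    (\<forall>p. graph_cycle G p \<and> card (cycle_verts G p) < card (verts G) \<longrightarrow> extendable G p)"

end

theory Submission
  imports Defs
begin

text \<open>
  Let \<open>C\<close> be a cycle that cannot be extended and \<open>x\<close> a vertex outside \<open>C\<close> with neighbors
  \<open>w\<^sub>1, \<dots>, w\<^sub>k\<close> on \<open>C\<close>, \<open>k \<ge> 1\<close>; let \<open>s\<^sub>i\<close> be the successor of \<open>w\<^sub>i\<close>. Then
  \<open>x, s\<^sub>1, \<dots>, s\<^sub>k\<close> are pairwise nonadjacent, and no vertex outside \<open>C\<close> is adjacent to both
  \<open>w\<^sub>i\<close> and \<open>s\<^sub>i\<close>. In the neighborhood of \<open>w\<^sub>i\<close> both \<open>x\<close> and \<open>s\<^sub>i\<close> are adjacent to at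
  least half of the vertices, so they have there at least as many common neighbors as common
  nonneighbors. The common neighbors are vertices \<open>w\<^sub>j\<close> adjacent to \<open>s\<^sub>i\<close>, whereas \<open>x\<close> and
  all \<open>s\<^sub>j\<close> adjacent to \<open>w\<^sub>i\<close> are common nonneighbors. Summing over \<open>i\<close>, both
  sides count the adjacent pairs \<open>(w\<^sub>i, s\<^sub>j)\<close>, but the nonneighbors
  contribute \<open>k\<close> more, a contradiction.
\<close>

section \<open>Cycles as vertex lists\<close>

definition vertex_cycle :: "('a \<Rightarrow> 'a \<Rightarrow> bool) \<Rightarrow> 'a list \<Rightarrow> bool" where
  "vertex_cycle R vs \<longleftrightarrow> vs \<noteq> [] \<and> distinct vs \<and> successively R vs \<and> R (last vs) (hd vs)"

lemma vertex_cycle_rotate1: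
  assumes "vertex_cycle R vs"
  shows "vertex_cycle R (rotate1 vs)"
proof -
  obtain u us where vs: "vs = u # us" using assms by (cases vs) (auto simp: vertex_cycle_def)
  show ?thesis
  proof (cases "us = []")
    case False
    with assms show ?thesis
      by (auto simp: vs vertex_cycle_def successively_append_iff successively_Cons)
  qed (use assms vs in simp)
qed

lemma vertex_cycle_rotate:
  assumes "vertex_cycle R vs"
  shows "vertex_cycle R (rotate k vs)"
  using assms by (induction k) (auto simp: vertex_cycle_rotate1)

lemma vertex_cycle_insert:
  assumes "vertex_cycle R vs" "symp R" "x \<notin> set vs" "R x (last vs)" "R x (hd vs)"
  shows "vertex_cycle R (x # vs)"
  using assms by (auto simp: vertex_cycle_def successively_Cons dest: sympD)

text \<open>The rerouting known from proofs of Dirac's theorem: from \<open>x\<close> to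
  \<open>last ys\<close>, back through \<open>ys\<close> to \<open>hd ys\<close>, across the chord
  to \<open>hd xs\<close>, forward through \<open>xs\<close> to \<open>last xs\<close>, and back to
  \<open>x\<close>. Only the two edges joining \<open>xs\<close> and \<open>ys\<close> are given
  up.\<close>

lemma vertex_cycle_insert_crossing:
  assumes "vertex_cycle R (xs @ ys)" "symp R" "x \<notin> set (xs @ ys)" "xs \<noteq> []" "ys \<noteq> []"
    and "R x (last xs)" "R x (last ys)" "R (hd xs) (hd ys)"
  shows "vertex_cycle R (x # rev ys @ xs)"
proof -
  have "(\<lambda>u v. R v u) = R"
    using \<open>symp R\<close> by (auto simp: fun_eq_iff dest: sympD)
  moreover have "successively R xs" "successively R ys"
    using assms(1) by (auto simp: vertex_cycle_def successively_append_iff)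
  ultimately have "successively R (rev ys)"
    by (simp only: successively_rev)
  with assms \<open>successively R xs\<close> show ?thesis
    by (auto simp: vertex_cycle_def successively_append_iff successively_Cons hd_rev last_rev
        dest: sympD)
qed

section \<open>Extending a cycle\<close>

text \<open>By inclusion-exclusion the right side minus the left is
  \<open>card (W \<inter> X) + card (W \<inter> Y) - card W\<close>.\<close>

lemma card_Int_ge_card_Diff:
  assumes "finite W" "card W \<le> 2 * card (W \<inter> X)" "card W \<le> 2 * card (W \<inter> Y)"
  shows "card (W - (X \<union> Y)) \<le> card (W \<inter> X \<inter> Y)"
proof -
  have "card (W \<inter> X) + card (W \<inter> Y) = card ((W \<inter> X) \<union> (W \<inter> Y)) + card ((W \<inter> X) \<inter> (W \<inter> Y))"
    using assms(1) by (intro card_Un_Int) auto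
  moreover have "(W \<inter> X) \<union> (W \<inter> Y) = W \<inter> (X \<union> Y)" "(W \<inter> X) \<inter> (W \<inter> Y) = W \<inter> X \<inter> Y"
    by auto
  moreover have "card W = card (W \<inter> (X \<union> Y)) + card (W - (X \<union> Y))"
    using assms(1) by (metis card_Int_Diff)
  ultimately show ?thesis using assms(2,3) by simp
qed

lemma sum_card_swap:
  assumes "finite A"
  shows "(\<Sum>i\<in>A. card {j \<in> A. P i j}) = (\<Sum>i\<in>A. card {j \<in> A. P j i})"
proof -
  have "(\<Sum>i\<in>A. card {j \<in> A. P i j}) = (\<Sum>i\<in>A. \<Sum>j\<in>A. of_bool (P i j))"
    using assms by (simp add: Int_def)
  also have "\<dots> = (\<Sum>i\<in>A. \<Sum>j\<in>A. of_bool (P j i))"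
    by (rule sum.swap)
  also have "\<dots> = (\<Sum>i\<in>A. card {j \<in> A. P j i})"
    using assms by (simp add: Int_def)
  finally show ?thesis .
qed

text \<open>\<open>Dirac\<close> is the local Dirac condition at \<open>u\<close>: the degree of
  \<open>v\<close> within the neighborhood of \<open>u\<close> is the number of their common
  neighbors. The edge from \<open>x\<close> to \<open>w\<close> will come from
  connectedness.\<close>

lemma vertex_cycle_extend:
  fixes R :: "'a \<Rightarrow> 'a \<Rightarrow> bool"
  assumes sym: "symp R" and irrefl: "irreflp R" and fin: "\<And>u. finite {v. R u v}"
    and Dirac: "\<And>u v. R u v \<Longrightarrow> card {w. R u w} \<le> 2 * card ({w. R u w} \<inter> {w. R v w})"
    and cyc: "vertex_cycle R vs" and x: "x \<notin> set vs" and w: "w \<in> set vs" "R x w"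
  obtains y ws where "vertex_cycle R ws" "y \<notin> set vs" "set ws = insert y (set vs)"
proof (rule ccontr)
  assume "\<not> thesis"
  with that have no_ext: "\<not> (vertex_cycle R ws \<and> set ws = insert y (set vs))" if "y \<notin> set vs" for y ws
    using \<open>y \<notin> set vs\<close> by blast
  have R_sym: "R u v \<longleftrightarrow> R v u" for u v using sym by (auto dest: sympD)
  have R_irrefl: "\<not> R u u" for u using irrefl by (auto dest: irreflpD)
  define n where "n = length vs"
  have "vs \<noteq> []" using cyc by (auto simp: vertex_cycle_def)
  hence "0 < n" by (simp add: n_def)
  have dist: "distinct vs" using cyc by (auto simp: vertex_cycle_def)
  \<comment> \<open>Positions in \<open>vs\<close> stand for vertices: \<open>I\<close> indexes the
    neighbors of \<open>x\<close> on the cycle, and the remainder modulo \<open>n\<close> makes the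
    first vertex follow the last.\<close>
  define s where "s i = vs ! (Suc i mod n)" for i
  define I where "I = {i. i < n \<and> R x (vs ! i)}"
  have [simp]: "finite I" by (simp add: I_def)
  have s_mem: "s i \<in> set vs" for i using \<open>0 < n\<close> by (auto simp: s_def n_def)
  have inj_s: "inj_on s I"
  proof (rule inj_onI)
    fix i j assume "i \<in> I" "j \<in> I" "s i = s j"
    hence "Suc i mod n = Suc j mod n"
      using dist \<open>0 < n\<close> by (simp add: s_def n_def nth_eq_iff_index_eq)
    with \<open>i \<in> I\<close> \<open>j \<in> I\<close> show "i = j" by (auto simp: I_def mod_Suc split: if_splits)
  qed
  have hd_rot: "hd (rotate (Suc i) vs) = s i" for i
    using \<open>vs \<noteq> []\<close> by (simp add: hd_rotate_conv_nth s_def n_def del: rotate_Suc)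
  have last_rot: "last (rotate (Suc i) vs) = vs ! i" if "i < n" for i
  proof -
    have "last (rotate (Suc i) vs) = vs ! ((Suc i + (n - 1)) mod n)"
      using \<open>0 < n\<close> \<open>vs \<noteq> []\<close> by (simp add: last_conv_nth nth_rotate n_def del: rotate_Suc)
    with that show ?thesis by simp
  qed
  have succ: "R (vs ! i) (s i)" if "i < n" for i
    using vertex_cycle_rotate[OF cyc, of "Suc i"] last_rot[OF that] hd_rot[of i]
    by (simp add: vertex_cycle_def del: rotate_Suc)
  \<comment> \<open>Rotated by \<open>Suc i\<close>, the list starts at \<open>s i\<close> and ends
    at \<open>vs ! i\<close>, so putting \<open>y\<close> in front inserts it between the
    two.\<close>
  have no_insert: "\<not> (R y (vs ! i) \<and> R y (s i))" if "i < n" "y \<notin> set vs" for y i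
    using vertex_cycle_insert[OF vertex_cycle_rotate[OF cyc, of "Suc i"] sym, of y]
      last_rot[OF that(1)] hd_rot[of i] no_ext[OF that(2), of "y # rotate (Suc i) vs"] that(2)
    by (auto simp del: rotate_Suc)
  have no_cross: "\<not> R (s i) (s j)" if "i \<in> I" "j \<in> I" for i j
  proof
    assume adj: "R (s i) (s j)"
    hence "i \<noteq> j" using R_irrefl by auto
    have less: "i < n" "j < n" using that by (auto simp: I_def)
    \<comment> \<open>The position of \<open>vs ! j\<close> in the cycle read from
      \<open>s i\<close>. As \<open>i\<close> itself has position \<open>n - 1\<close>,
      \<open>Suc m < n\<close> and both pieces cut after position \<open>m\<close> are nonempty:
      \<open>xs\<close> runs from \<open>s i\<close> to \<open>vs ! j\<close>, and \<open>ys\<close>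
      from \<open>s j\<close> to \<open>vs ! i\<close>.\<close>
    define m where "m = (if i < j then j - Suc i else j + n - Suc i)"
    have m: "Suc m < n" "(Suc i + m) mod n = j"
      using less \<open>i \<noteq> j\<close> by (auto simp: m_def)
    have Suc_m: "(Suc i + Suc m) mod n = Suc j mod n"
      using m(2) by (metis add_Suc_right mod_Suc_eq)
    define us where "us = rotate (Suc i) vs"
    have len: "length us = n" by (simp add: us_def n_def)
    define xs ys where "xs = take (Suc m) us" and "ys = drop (Suc m) us"
    have us: "us = xs @ ys" by (simp add: xs_def ys_def)
    have ne: "xs \<noteq> []" "ys \<noteq> []" using m(1) len by (auto simp: xs_def ys_def)
    have "last xs = us ! m"
      using m(1) len by (simp add: xs_def take_Suc_conv_app_nth)
    also have "\<dots> = vs ! j"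
      using m by (simp add: us_def nth_rotate n_def del: rotate_Suc)
    finally have "last xs = vs ! j" .
    moreover have "hd ys = us ! Suc m"
      using m(1) len by (simp add: ys_def hd_drop_conv_nth)
    hence "hd ys = s j"
      using m(1) Suc_m by (simp add: us_def nth_rotate n_def s_def del: rotate_Suc)
    moreover have "last ys = vs ! i"
      using last_rot[OF less(1)] us ne by (simp add: us_def[symmetric] del: rotate_Suc)
    moreover have "hd xs = s i"
      using hd_rot[of i] us ne by (simp add: us_def[symmetric] del: rotate_Suc)
    moreover have set_us: "set xs \<union> set ys = set vs"
      using us by (metis set_append set_rotate us_def)
    moreover have "vertex_cycle R (xs @ ys)"
      using vertex_cycle_rotate[OF cyc, of "Suc i"] us by (simp add: us_def)
    ultimately have "vertex_cycle R (x # rev ys @ xs)"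
      using that adj ne x by (intro vertex_cycle_insert_crossing sym) (auto simp: I_def)
    moreover have "set (x # rev ys @ xs) = insert x (set vs)"
      using set_us by auto
    ultimately show False using no_ext[OF x] by blast
  qed
  \<comment> \<open>The inequality is strict because \<open>x\<close> is a common nonneighbor
    besides the vertices \<open>s j\<close>.\<close>
  have bound: "card {j \<in> I. R (vs ! i) (s j)} < card {j \<in> I. R (vs ! j) (s i)}" if "i \<in> I" for i
  proof -
    let ?W = "{v. R (vs ! i) v}" and ?X = "{v. R x v}" and ?S = "{v. R (s i) v}"
    have i: "i < n" "R x (vs ! i)" using that by (auto simp: I_def)
    have "Suc (card {j \<in> I. R (vs ! i) (s j)}) = card (insert x (s ` {j \<in> I. R (vs ! i) (s j)}))"
      using s_mem x by (subst card_insert_disjoint)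
        (auto intro!: card_image[symmetric] inj_on_subset[OF inj_s])
    also have "\<dots> \<le> card (?W - (?X \<union> ?S))"
    proof (rule card_mono)
      have "\<not> R x (s j)" if "j \<in> I" for j
        using no_insert[of j x] that x by (auto simp: I_def)
      thus "insert x (s ` {j \<in> I. R (vs ! i) (s j)}) \<subseteq> ?W - (?X \<union> ?S)"
        using i R_irrefl R_sym no_cross \<open>i \<in> I\<close> by auto
    qed (use fin in auto)
    also have "\<dots> \<le> card (?W \<inter> ?X \<inter> ?S)"
      using Dirac[of "vs ! i" x] Dirac[OF succ[OF i(1)]] i(2) R_sym[of x] fin
      by (intro card_Int_ge_card_Diff) auto
    \<comment> \<open>A common neighbor of \<open>vs ! i\<close> and \<open>s i\<close> off the
      cycle could be inserted between them; so it lies on the cycle and, being adjacent to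
      \<open>x\<close>, has its position in \<open>I\<close>.\<close>
    also have "\<dots> \<le> card ((!) vs ` {j \<in> I. R (vs ! j) (s i)})"
    proof (rule card_mono)
      show "?W \<inter> ?X \<inter> ?S \<subseteq> (!) vs ` {j \<in> I. R (vs ! j) (s i)}"
      proof
        fix v assume v: "v \<in> ?W \<inter> ?X \<inter> ?S"
        hence "v \<in> set vs" using no_insert[OF i(1), of v] R_sym by auto
        then obtain j where "j < n" "v = vs ! j" by (auto simp: in_set_conv_nth n_def)
        with v R_sym show "v \<in> (!) vs ` {j \<in> I. R (vs ! j) (s i)}" by (auto simp: I_def)
      qed
    qed auto
    also have "\<dots> \<le> card {j \<in> I. R (vs ! j) (s i)}"
      by (rule card_image_le) auto
    finally show ?thesis by simp
  qed
  obtain i where "i < n" "vs ! i = w" using w by (auto simp: in_set_conv_nth n_def)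
  hence "I \<noteq> {}" using w by (auto simp: I_def)
  hence "(\<Sum>i\<in>I. card {j \<in> I. R (vs ! i) (s j)}) < (\<Sum>i\<in>I. card {j \<in> I. R (vs ! j) (s i)})"
    using bound by (intro sum_strict_mono) auto
  thus False using sum_card_swap[of I "\<lambda>i j. R (vs ! i) (s j)"] by simp
qed

section \<open>Arc walks and local degrees\<close>

lemma (in wf_digraph) awalk_imp_successively:
  assumes "awalk u p v"
  shows "successively (dominates G) (awalk_verts u p)"
  using assms
proof (induction p arbitrary: u)
  case (Cons e p)
  hence "awalk (head G e) p v" "tail G e \<rightarrow>\<^bsub>G\<^esub> head G e"
    by (auto simp: awalk_Cons_iff arcs_ends_conv)
  with Cons.IH show ?case
    by (auto simp: successively_Cons)
qed simp

lemma (in wf_digraph) successively_imp_awalk: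
  assumes "successively (dominates G) (u # vs)" "u \<in> verts G"
  obtains p where "awalk u p (last (u # vs))" "awalk_verts u p = u # vs"
  using assms
proof (induction vs arbitrary: u thesis)
  case Nil
  thus ?case by (auto simp: awalk_Nil_iff intro: Nil(1)[of "[]"])
next
  case (Cons v vs)
  then obtain e where e: "e \<in> arcs G" "tail G e = u" "head G e = v"
    by (auto simp: successively_Cons)
  with Cons obtain p where "awalk v p (last (v # vs))" "awalk_verts v p = v # vs"
    by (metis adj_in_verts(2) head_in_verts successively.simps(3))
  with e Cons(2)[of "e # p"] show ?case by (auto simp: awalk_Cons_iff)
qed

lemma (in wf_digraph) cycle_imp_vertex_cycle:
  assumes "cycle p"
  obtains vs where "vertex_cycle (dominates G) vs" "set vs = cycle_verts G p"
proof -
  obtain u where u: "awalk u p u" "distinct (tl (awalk_verts u p))" "p \<noteq> []"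
    using assms by (auto simp: cycle_def)
  \<comment> \<open>The tails of the arcs list each vertex once, whereas \<open>awalk_verts\<close>
    repeats the start \<open>u\<close> at the end.\<close>
  define vs where "vs = map (tail G) p"
  have verts: "awalk_verts u p = vs @ [u]"
    using u by (auto simp: awalk_verts_conv vs_def elim!: awalkE)
  have "hd vs = u" "vs \<noteq> []"
    using u by (cases p; auto simp: awalk_Cons_iff vs_def)+
  moreover have "distinct vs"
    using u(2) \<open>hd vs = u\<close> \<open>vs \<noteq> []\<close> by (cases vs) (auto simp: verts)
  moreover have "successively (dominates G) (vs @ [u])"
    using awalk_imp_successively[OF u(1)] by (simp only: verts)
  ultimately have "vertex_cycle (dominates G) vs"
    by (auto simp: vertex_cycle_def successively_append_iff)
  moreover have "set vs = cycle_verts G p"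
    by (simp add: vs_def cycle_verts_def)
  ultimately show thesis by (rule that)
qed

lemma (in wf_digraph) vertex_cycle_imp_cycle:
  assumes "vertex_cycle (dominates G) vs"
  obtains p where "cycle p" "cycle_verts G p = set vs"
proof -
  obtain u us where vs: "vs = u # us" using assms by (cases vs) (auto simp: vertex_cycle_def)
  have "successively (dominates G) (vs @ [u])"
    using assms unfolding successively_append_iff by (simp add: vs vertex_cycle_def)
  hence "successively (dominates G) (u # us @ [u])" by (simp only: vs append_Cons)
  moreover have "last vs \<rightarrow>\<^bsub>G\<^esub> u" using assms by (simp add: vs vertex_cycle_def)
  hence "u \<in> verts G" by (rule adj_in_verts(2))
  ultimately obtain p where p: "awalk u p (last (u # us @ [u]))" "awalk_verts u p = u # us @ [u]"
    by (rule successively_imp_awalk)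
  hence "p \<noteq> []" by auto
  hence "map (tail G) p @ [head G (last p)] = (u # us) @ [u]"
    using p(2) by (simp add: awalk_verts_conv)
  hence "map (tail G) p = vs" by (simp only: vs append1_eq_conv)
  hence "cycle_verts G p = set vs" by (metis cycle_verts_def set_map)
  moreover have "cycle p"
    unfolding cycle_def
    using p \<open>p \<noteq> []\<close> assms by (intro exI[of _ u]) (simp add: vs vertex_cycle_def)
  ultimately show thesis using that by blast
qed

section \<open>Degrees within neighborhoods\<close>

lemma (in nomulti_digraph) out_degree_eq_card:
  "out_degree G u = card {v. u \<rightarrow>\<^bsub>G\<^esub> v}"
proof -
  have "{v. u \<rightarrow>\<^bsub>G\<^esub> v} = head G ` out_arcs G u"
    by (auto simp: arcs_ends_conv)
  moreover have "inj_on (head G) (out_arcs G u)"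
    by (rule inj_onI) (auto intro: no_multi_arcs simp: arc_to_ends_def)
  ultimately show ?thesis by (simp add: out_degree_def card_image)
qed

lemma dominates_induce_subgraph:
  "u \<rightarrow>\<^bsub>G \<restriction> S\<^esub> v \<longleftrightarrow> u \<rightarrow>\<^bsub>G\<^esub> v \<and> u \<in> S \<and> v \<in> S"
  by (auto simp: arcs_ends_conv)

lemma (in graph) locally_Dirac_imp_card_le:
  assumes "locally_Dirac G" "u \<rightarrow>\<^bsub>G\<^esub> v"
  shows "card {w. u \<rightarrow>\<^bsub>G\<^esub> w} \<le> 2 * card ({w. u \<rightarrow>\<^bsub>G\<^esub> w} \<inter> {w. v \<rightarrow>\<^bsub>G\<^esub> w})"
proof -
  let ?N = "neighborhood G u"
  let ?H = "G \<restriction> ?N"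
  interpret H: nomulti_digraph ?H
    by unfold_locales (auto simp: arc_to_ends_def intro!: no_multi_arcs)
  have "v \<in> ?N" using assms(2) by (simp add: neighborhood_def)
  have "finite ?N"
    by (rule finite_subset[OF _ finite_verts]) (auto simp: neighborhood_def dest: adj_in_verts)
  \<comment> \<open>Since \<open>v\<close> lies in the neighborhood, the default value 0 of
    \<open>min_degree\<close> does not arise and \<open>Min\<close> is a true minimum.\<close>
  have "min_degree ?H \<le> out_degree ?H v"
    using \<open>v \<in> ?N\<close> \<open>finite ?N\<close> by (auto simp: min_degree_def)
  also have "out_degree ?H v = card {w. v \<rightarrow>\<^bsub>?H\<^esub> w}"
    by (rule H.out_degree_eq_card)
  also have "{w. v \<rightarrow>\<^bsub>?H\<^esub> w} = {w. u \<rightarrow>\<^bsub>G\<^esub> w} \<inter> {w. v \<rightarrow>\<^bsub>G\<^esub> w}"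
    using \<open>v \<in> ?N\<close> by (auto simp: dominates_induce_subgraph neighborhood_def)
  finally have "min_degree ?H \<le> card ({w. u \<rightarrow>\<^bsub>G\<^esub> w} \<inter> {w. v \<rightarrow>\<^bsub>G\<^esub> w})" .
  moreover have "out_degree G u \<le> 2 * min_degree ?H"
    using assms adj_in_verts(1)[OF assms(2)] by (auto simp only: locally_Dirac_def)
  ultimately show ?thesis by (simp only: out_degree_eq_card)
qed

section \<open>Connectedness and the conclusion\<close>

lemma (in wf_digraph) reachable_leaves_set:
  assumes "u \<rightarrow>\<^sup>*\<^bsub>G\<^esub> v" "u \<in> S" "v \<notin> S"
  shows "\<exists>w x. w \<rightarrow>\<^bsub>G\<^esub> x \<and> w \<in> S \<and> x \<notin> S"
  using assms by (induction rule: converse_reachable_induct) blast+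

theorem corollary11:
  fixes G :: "('a, 'b) pre_digraph"
  assumes "Digraph.graph G"
    and "Digraph_Component.connected G"
    and "card (verts G) \<ge> 3"
    and "locally_Dirac G"
  shows "fully_cycle_extendable G"
proof -
  interpret graph G by fact
  have reach: "u \<rightarrow>\<^sup>*\<^bsub>G\<^esub> v" if "u \<in> verts G" "v \<in> verts G" for u v
    using symmetric_connected_imp_strongly_connected[OF sym_arcs assms(2)] that by auto
  have sym: "symp (dominates G)"
    using sym_arcs by (auto intro: sympI arcs_ends_symmetric)
  have irrefl: "irreflp (dominates G)"
    using adj_not_same by (intro irreflpI notI)
  have fin: "finite {v. u \<rightarrow>\<^bsub>G\<^esub> v}" for u
    by (rule finite_subset[OF _ finite_verts]) (auto dest: adj_in_verts)
  note Dirac = locally_Dirac_imp_card_le[OF assms(4)]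
  have "\<exists>p. graph_cycle G p \<and> card (cycle_verts G p) = 3 \<and> u \<in> cycle_verts G p"
    if u: "u \<in> verts G" for u
  proof -
    \<comment> \<open>A second vertex and connectedness give \<open>u\<close> a neighbor
      \<open>v\<close>; the degree of \<open>u\<close> is then positive, so the local condition
      forces a common neighbor of \<open>u\<close> and \<open>v\<close>, which closes a
      triangle.\<close>
    have "\<not> verts G \<subseteq> {u}" using assms(3) card_mono[of "{u}" "verts G"] by auto
    then obtain b where "b \<in> verts G" "b \<notin> {u}" by auto
    then obtain v where "u \<rightarrow>\<^bsub>G\<^esub> v"
      using reachable_leaves_set[OF reach[OF u], of b "{u}"] by auto
    moreover from this have "card {w. u \<rightarrow>\<^bsub>G\<^esub> w} > 0" using fin by (auto simp: card_gt_0_iff)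
    ultimately have "{w. u \<rightarrow>\<^bsub>G\<^esub> w} \<inter> {w. v \<rightarrow>\<^bsub>G\<^esub> w} \<noteq> {}"
      using Dirac[of u v] by auto
    then obtain w where w: "u \<rightarrow>\<^bsub>G\<^esub> w" "v \<rightarrow>\<^bsub>G\<^esub> w" by auto
    with \<open>u \<rightarrow>\<^bsub>G\<^esub> v\<close> have dist: "u \<noteq> v" "u \<noteq> w" "v \<noteq> w"
      using adj_not_same by blast+
    hence "vertex_cycle (dominates G) [u, v, w]"
      using w \<open>u \<rightarrow>\<^bsub>G\<^esub> v\<close> sympD[OF sym] by (auto simp: vertex_cycle_def)
    then obtain p where "cycle p" "cycle_verts G p = set [u, v, w]"
      by (rule vertex_cycle_imp_cycle)
    with dist show ?thesis by (intro exI[of _ p]) (auto simp: graph_cycle_def)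
  qed
  moreover have "extendable G p"
    if p: "graph_cycle G p" "card (cycle_verts G p) < card (verts G)" for p
  proof -
    obtain vs where vs: "vertex_cycle (dominates G) vs" "set vs = cycle_verts G p"
      using p(1) cycle_imp_vertex_cycle unfolding graph_cycle_def by blast
    obtain a where a: "a \<in> set vs" using vs(1) by (cases vs) (auto simp: vertex_cycle_def)
    obtain b where b: "b \<in> verts G" "b \<notin> set vs"
      using p(2) card_mono[of "set vs" "verts G"] by (auto simp: vs(2)[symmetric])
    have "a \<in> verts G"
      using p(1) a unfolding vs(2) by (auto simp: graph_cycle_def cycle_def cycle_verts_def awalk_def)
    \<comment> \<open>A walk from \<open>a\<close> on the cycle to \<open>b\<close> off it must
      leave the cycle along some edge.\<close>
    then obtain w x where wx: "w \<rightarrow>\<^bsub>G\<^esub> x" "w \<in> set vs" "x \<notin> set vs"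
      using reachable_leaves_set[OF reach[OF _ b(1)] a b(2)] by blast
    then obtain y ws where ws: "vertex_cycle (dominates G) ws" "y \<notin> set vs" "set ws = insert y (set vs)"
      using vertex_cycle_extend[OF sym irrefl fin Dirac vs(1) wx(3,2) sympD[OF sym wx(1)]] by blast
    obtain q where "cycle q" "cycle_verts G q = set ws"
      using vertex_cycle_imp_cycle[OF ws(1)] .
    \<comment> \<open>The new cycle has one more vertex than \<open>p\<close>, hence at least
      three.\<close>
    with ws p(1) vs(2)[symmetric] show ?thesis
      by (auto simp: extendable_def graph_cycle_def intro!: exI[of _ q])
  qed
  ultimately show ?thesis by (simp add: fully_cycle_extendable_def)
qed

end
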